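(* Let $\gamma_P:\mathbb{R}^n\to\mathbb{R}$ be concave and $\rho_P:\mathbb{R}^n\to\mathbb{R}$ be convex, both continuously differentiable with Lipschitz continuous gradients, let $(\rho_P^{\text{ref}},\gamma_P^{\text{ref}})\in\mathbb{R}^2$, and let $\Delta$, $X$ and $A$ be as defined in the context. Let $\overline x\in X$ be stationary for the problem of maximizing $A$ over $X$, that is, $$-\nabla A(\overline x)^{T}(x-\overline x)\ge 0\quad\text{for all } x\in X,$$ and suppose that $A(\overline x)>0$. Then $\overline x$ is a global solution of the problem of maximizing $A(x)$ over $x\in X$ and, in turn, a global Pareto optimum of the two-objective problem of simultaneously maximizing $\gamma_P(x)$ and minimizing $\rho_P(x)$ over $x\in\Delta$.
   Context: $\Delta=\{x\in\mathbb{R}^n : x\ge 0,\ \sum_{i=1}^n x_i=1\}$ is the unit simplex. $X=\{x\in\Delta : \gamma_P(x)\ge\gamma_P^{\text{ref}},\ \rho_P(x)\le\rho_P^{\text{ref}}\}$ and $A(x)=\big(\gamma_P(x)-\gamma_P^{\text{ref}}\big)\big(\rho_P^{\text{ref}}-\rho_P(x)\big)$. A point $\bar x\in\Delta$ is a global Pareto optimum of the two-objective problem if there is no $x\in\Delta$ with $\gamma_P(x)\ge\gamma_P(\bar x)$ and $\rho_P(x)\le\rho_P(\bar x)$, with at least one of these two inequalities strict. *)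

theory Defs
  imports "HOL-Analysis.Analysis"
begin

definition gradient :: "('a::euclidean_space \<Rightarrow> real) \<Rightarrow> 'a \<Rightarrow> 'a"
  where "gradient f x = (THE d. GDERIV f x :> d)"

lemma gradient_eqI:
  assumes "GDERIV f x :> d"
  shows "gradient f x = d"
  unfolding gradient_def
proof (rule the_equality)
  show "GDERIV f x :> d" by (fact assms)
next
  fix e assume "GDERIV f x :> e"
  with assms have "(\<lambda>h. h \<bullet> e) = (\<lambda>h. h \<bullet> d)"
    unfolding gderiv_def by (intro has_derivative_unique)
  then have "\<forall>h. h \<bullet> e = h \<bullet> d"
    by (simp add: fun_eq_iff)
  then show "e = d"
    using vector_eq_rdot[of e d] vector_eq_ldot[of e d] by blast
qed

lemma GDERIV_gradient:
  assumes "f differentiable (at x)"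
  shows "GDERIV f x :> gradient f x"
proof -
  obtain D where D: "(f has_derivative D) (at x)"
    using assms unfolding differentiable_def by blast
  then have "linear D"
    by (rule has_derivative_linear)
  then have "D = (\<lambda>h. h \<bullet> adjoint D 1)"
    by (simp add: fun_eq_iff adjoint_works)
  with D have "GDERIV f x :> adjoint D 1"
    unfolding gderiv_def by metis
  then show ?thesis
    by (simp add: gradient_eqI)
qed

definition continuously_differentiable :: "('a::euclidean_space \<Rightarrow> real) \<Rightarrow> bool"
  where "continuously_differentiable f \<longleftrightarrow>
    (\<forall>x. f differentiable (at x)) \<and> continuous_on UNIV (gradient f)"

definition unit_simplex :: "(real ^ 'n) set"
  where "unit_simplex = {x. (\<forall>i. 0 \<le> x $ i) \<and> (\<Sum>i\<in>UNIV. x $ i) = 1}"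

definition ref_feasible ::
    "(real ^ 'n \<Rightarrow> real) \<Rightarrow> (real ^ 'n \<Rightarrow> real) \<Rightarrow> real \<Rightarrow> real \<Rightarrow> (real ^ 'n) set"
  where "ref_feasible \<gamma> \<rho> \<gamma>ref \<rho>ref = {x \<in> unit_simplex. \<gamma> x \<ge> \<gamma>ref \<and> \<rho> x \<le> \<rho>ref}"

definition ref_area ::
    "(real ^ 'n \<Rightarrow> real) \<Rightarrow> (real ^ 'n \<Rightarrow> real) \<Rightarrow> real \<Rightarrow> real \<Rightarrow> real ^ 'n \<Rightarrow> real"
  where "ref_area \<gamma> \<rho> \<gamma>ref \<rho>ref x = (\<gamma> x - \<gamma>ref) * (\<rho>ref - \<rho> x)"

definition stationary_max :: "('a::euclidean_space \<Rightarrow> real) \<Rightarrow> 'a set \<Rightarrow> 'a \<Rightarrow> bool"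
  where "stationary_max f S x \<longleftrightarrow> x \<in> S \<and> (\<forall>y\<in>S. - gradient f x \<bullet> (y - x) \<ge> 0)"

definition global_pareto_optimum :: "('a \<Rightarrow> real) \<Rightarrow> ('a \<Rightarrow> real) \<Rightarrow> 'a set \<Rightarrow> 'a \<Rightarrow> bool"
  where "global_pareto_optimum g r S x \<longleftrightarrow> x \<in> S \<and>
    \<not> (\<exists>y\<in>S. g y \<ge> g x \<and> r y \<le> r x \<and> (g y > g x \<or> r y < r x))"

end

theory Submission
  imports Defs
begin

text \<open>
  Write \<open>a = \<gamma> xbar - \<gamma>ref\<close> and \<open>b = \<rho>ref - \<rho> xbar\<close> for the sides of the rectangle whose area is
  maximised. Both are nonnegative by feasibility, so positivity of the area makes both positive.
  The area is in general not concave in \<open>x\<close>; but the product rule gives its gradient at \<open>xbar\<close> as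
  \<open>b \<nabla>\<gamma> - a \<nabla>\<rho>\<close>, which is also the gradient at \<open>xbar\<close> of the function
  \<open>x \<mapsto> b (\<gamma> x - \<gamma>ref) + a (\<rho>ref - \<rho> x)\<close>. The latter is concave because the weights \<open>a\<close> and \<open>b\<close> are
  positive, so stationarity of \<open>xbar\<close> makes \<open>2 a b\<close>, its value at \<open>xbar\<close>, its maximum over the
  feasible set.
  By the inequality of arithmetic and geometric means, two nonnegative sides \<open>p\<close> and \<open>q\<close> with
  \<open>b p + a q \<le> 2 a b\<close> satisfy \<open>p q \<le> a b\<close> (lemma \<open>mult_le_of_weighted_sum_le\<close>), and this is
  the global maximality of the area.

  A point that dominates \<open>xbar\<close> is feasible for the reference values as well, and enlarges one side
  of the rectangle without shrinking the other. Since both sides at \<open>xbar\<close> are positive, the area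
  would grow strictly, contradicting maximality.
\<close>

text \<open>
  On the line through \<open>x\<close> and \<open>y\<close> the function is a convex function of one real variable, whose
  graph lies above its tangent.
\<close>
lemma convex_on_above_gradient:
  fixes f :: "'a::euclidean_space \<Rightarrow> real"
  assumes f: "convex_on UNIV f" and d: "GDERIV f x :> g"
  shows "f x + (y - x) \<bullet> g \<le> f y"
proof -
  define \<phi> where "\<phi> t = f (x + t *\<^sub>R (y - x))" for t :: real
  have "convex_on UNIV \<phi>"
  proof (rule convex_onI)
    fix t u v :: real
    assume t: "0 < t" "t < 1"
    have "x + ((1 - t) *\<^sub>R u + t *\<^sub>R v) *\<^sub>R (y - x)
        = (1 - t) *\<^sub>R (x + u *\<^sub>R (y - x)) + t *\<^sub>R (x + v *\<^sub>R (y - x))"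
      by (simp add: algebra_simps)
    then show "\<phi> ((1 - t) *\<^sub>R u + t *\<^sub>R v) \<le> (1 - t) * \<phi> u + t * \<phi> v"
      unfolding \<phi>_def using t convex_onD[OF f, of t] by simp
  qed simp
  moreover have "(\<phi> has_field_derivative (y - x) \<bullet> g) (at 0)"
  proof -
    have l: "((\<lambda>t. x + t *\<^sub>R (y - x)) has_derivative (\<lambda>t. t *\<^sub>R (y - x))) (at (0::real))"
      by (auto intro!: derivative_eq_intros)
    have "(f has_derivative (\<lambda>h. h \<bullet> g)) (at (x + (0::real) *\<^sub>R (y - x)))"
      using d by (simp add: gderiv_def)
    from has_derivative_compose[OF l this]
    show ?thesis
      by (simp add: \<phi>_def[abs_def] has_field_derivative_def mult.commute[of _ "(y - x) \<bullet> g"])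
  qed
  ultimately have "\<phi> 1 - \<phi> 0 \<ge> (y - x) \<bullet> g * (1 - 0)"
    by (intro convex_on_imp_above_tangent[where A = UNIV]) auto
  then show ?thesis
    by (simp add: \<phi>_def)
qed

lemma concave_on_below_gradient:
  fixes f :: "'a::euclidean_space \<Rightarrow> real"
  assumes f: "concave_on UNIV f" and d: "GDERIV f x :> g"
  shows "f y \<le> f x + (y - x) \<bullet> g"
proof -
  have "- f x + (y - x) \<bullet> (- g) \<le> - f y"
    using f GDERIV_minus[OF d] unfolding concave_on_def
    by (intro convex_on_above_gradient)
  then show ?thesis
    by simp
qed

text \<open>
  Apply \<open>4 u v \<le> (u + v)\<^sup>2\<close> to \<open>u = b p\<close> and \<open>v = a q\<close>, and cancel the factor \<open>4 a b\<close>.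
\<close>
lemma mult_le_of_weighted_sum_le:
  fixes a b p q :: real
  assumes "0 < a" "0 < b" "0 \<le> p" "0 \<le> q" and le: "b * p + a * q \<le> 2 * (a * b)"
  shows "p * q \<le> a * b"
proof -
  have "4 * (a * b) * (p * q) \<le> (b * p + a * q)\<^sup>2"
    using zero_le_power2[of "b * p - a * q"]
    by (simp add: power2_eq_square algebra_simps)
  also have "\<dots> \<le> (2 * (a * b))\<^sup>2"
    using assms by (intro power_mono) auto
  also have "\<dots> = 4 * (a * b) * (a * b)"
    by (simp add: power2_eq_square)
  finally show ?thesis
    using assms by simp
qed

lemma gradient_ref_area:
  fixes \<gamma> \<rho> :: "real ^ 'n \<Rightarrow> real"
  assumes g: "GDERIV \<gamma> x :> g" and r: "GDERIV \<rho> x :> r"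
  shows "gradient (ref_area \<gamma> \<rho> \<gamma>ref \<rho>ref) x = (\<rho>ref - \<rho> x) *\<^sub>R g - (\<gamma> x - \<gamma>ref) *\<^sub>R r"
proof (rule gradient_eqI)
  have "GDERIV (\<lambda>x. (\<gamma> x - \<gamma>ref) * (\<rho>ref - \<rho> x)) x
      :> (\<gamma> x - \<gamma>ref) *\<^sub>R (0 - r) + (\<rho>ref - \<rho> x) *\<^sub>R (g - 0)"
    using g r by (intro GDERIV_mult GDERIV_diff GDERIV_const)
  then show "GDERIV (ref_area \<gamma> \<rho> \<gamma>ref \<rho>ref) x
      :> (\<rho>ref - \<rho> x) *\<^sub>R g - (\<gamma> x - \<gamma>ref) *\<^sub>R r"
    by (simp add: ref_area_def[abs_def])
qed

lemma ref_feasible_ref_area_pos: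
  assumes "x \<in> ref_feasible \<gamma> \<rho> \<gamma>ref \<rho>ref" and "ref_area \<gamma> \<rho> \<gamma>ref \<rho>ref x > 0"
  shows "\<gamma> x > \<gamma>ref" and "\<rho> x < \<rho>ref"
  using assms by (auto simp: ref_feasible_def ref_area_def zero_less_mult_iff)

text \<open>
  Stationarity bounds the linearisation of the area by \<open>0\<close>; the tangent inequalities for \<open>\<gamma>\<close>
  and \<open>\<rho>\<close>, weighted by the sides of the rectangle, turn this into the hypothesis of
  the lemma \<open>mult_le_of_weighted_sum_le\<close>.
\<close>
lemma stationary_ref_area_maximal:
  fixes \<gamma> \<rho> :: "real ^ 'n \<Rightarrow> real"
  assumes \<gamma>: "concave_on UNIV \<gamma>" "\<gamma> differentiable (at x)"
    and \<rho>: "convex_on UNIV \<rho>" "\<rho> differentiable (at x)"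
    and stat: "stationary_max (ref_area \<gamma> \<rho> \<gamma>ref \<rho>ref) (ref_feasible \<gamma> \<rho> \<gamma>ref \<rho>ref) x"
    and pos: "ref_area \<gamma> \<rho> \<gamma>ref \<rho>ref x > 0"
    and y: "y \<in> ref_feasible \<gamma> \<rho> \<gamma>ref \<rho>ref"
  shows "ref_area \<gamma> \<rho> \<gamma>ref \<rho>ref y \<le> ref_area \<gamma> \<rho> \<gamma>ref \<rho>ref x"
proof -
  define a where "a = \<gamma> x - \<gamma>ref"
  define b where "b = \<rho>ref - \<rho> x"
  define s where "s = (y - x) \<bullet> gradient \<gamma> x"
  define t where "t = (y - x) \<bullet> gradient \<rho> x"
  note g = GDERIV_gradient[OF \<gamma>(2)] and r = GDERIV_gradient[OF \<rho>(2)]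
  have ab: "0 < a" "0 < b"
    using ref_feasible_ref_area_pos[OF _ pos] stat by (auto simp: a_def b_def stationary_max_def)
  have "gradient (ref_area \<gamma> \<rho> \<gamma>ref \<rho>ref) x \<bullet> (y - x) \<le> 0"
    using stat y by (auto simp: stationary_max_def)
  then have lin: "b * s - a * t \<le> 0"
    by (simp add: gradient_ref_area[OF g r] inner_diff_left[of "_ *\<^sub>R _"] a_def b_def s_def t_def
        inner_commute[of "y - x"])
  have "\<gamma> y - \<gamma>ref \<le> a + s"
    using concave_on_below_gradient[OF \<gamma>(1) g, of y] by (simp add: a_def s_def)
  moreover have "\<rho>ref - \<rho> y \<le> b - t"
    using convex_on_above_gradient[OF \<rho>(1) r, of y] by (simp add: b_def t_def)
  ultimately have "b * (\<gamma> y - \<gamma>ref) + a * (\<rho>ref - \<rho> y) \<le> b * (a + s) + a * (b - t)"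
    using ab by (intro add_mono mult_left_mono) auto
  also have "\<dots> \<le> 2 * (a * b)"
    using lin by (simp add: algebra_simps)
  finally have "(\<gamma> y - \<gamma>ref) * (\<rho>ref - \<rho> y) \<le> a * b"
    using ab y by (intro mult_le_of_weighted_sum_le) (auto simp: ref_feasible_def)
  then show ?thesis
    by (simp add: ref_area_def a_def b_def)
qed

lemma ref_area_strict_mono:
  assumes "\<gamma> x > \<gamma>ref" "\<rho> x < \<rho>ref"
    and "\<gamma> y \<ge> \<gamma> x" "\<rho> y \<le> \<rho> x" "\<gamma> y > \<gamma> x \<or> \<rho> y < \<rho> x"
  shows "ref_area \<gamma> \<rho> \<gamma>ref \<rho>ref x < ref_area \<gamma> \<rho> \<gamma>ref \<rho>ref y"
  using assms(5) unfolding ref_area_def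
proof
  assume "\<gamma> y > \<gamma> x"
  then show "(\<gamma> x - \<gamma>ref) * (\<rho>ref - \<rho> x) < (\<gamma> y - \<gamma>ref) * (\<rho>ref - \<rho> y)"
    using assms by (intro mult_less_le_imp_less) auto
next
  assume "\<rho> y < \<rho> x"
  then show "(\<gamma> x - \<gamma>ref) * (\<rho>ref - \<rho> x) < (\<gamma> y - \<gamma>ref) * (\<rho>ref - \<rho> y)"
    using assms by (intro mult_le_less_imp_less) auto
qed

text \<open>
  The reference constraints are inherited by every point that dominates a feasible one, so a
  maximiser over the constrained set is Pareto optimal over the whole simplex.
\<close>
lemma ref_area_maximal_imp_pareto:
  assumes x: "x \<in> ref_feasible \<gamma> \<rho> \<gamma>ref \<rho>ref"
    and pos: "ref_area \<gamma> \<rho> \<gamma>ref \<rho>ref x > 0"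
    and max: "\<And>y. y \<in> ref_feasible \<gamma> \<rho> \<gamma>ref \<rho>ref \<Longrightarrow>
      ref_area \<gamma> \<rho> \<gamma>ref \<rho>ref y \<le> ref_area \<gamma> \<rho> \<gamma>ref \<rho>ref x"
  shows "global_pareto_optimum \<gamma> \<rho> unit_simplex x"
  unfolding global_pareto_optimum_def
proof (intro conjI notI)
  show "x \<in> unit_simplex"
    using x by (simp add: ref_feasible_def)
next
  assume "\<exists>y\<in>unit_simplex. \<gamma> y \<ge> \<gamma> x \<and> \<rho> y \<le> \<rho> x \<and> (\<gamma> y > \<gamma> x \<or> \<rho> y < \<rho> x)"
  then obtain y where y: "y \<in> unit_simplex" "\<gamma> y \<ge> \<gamma> x" "\<rho> y \<le> \<rho> x"
    "\<gamma> y > \<gamma> x \<or> \<rho> y < \<rho> x"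
    by blast
  then have "y \<in> ref_feasible \<gamma> \<rho> \<gamma>ref \<rho>ref"
    using x by (auto simp: ref_feasible_def)
  from max[OF this] show False
    using ref_area_strict_mono[of \<gamma>ref \<gamma> x \<rho> \<rho>ref y] ref_feasible_ref_area_pos[OF x pos] y by simp
qed

theorem proposition3p1:
  fixes \<gamma> \<rho> :: "real ^ 'n \<Rightarrow> real"
    and \<gamma>ref \<rho>ref :: real
    and xbar :: "real ^ 'n"
  assumes "concave_on UNIV \<gamma>"
    and "convex_on UNIV \<rho>"
    and "continuously_differentiable \<gamma>"
    and "continuously_differentiable \<rho>"
    and "\<exists>L. L-lipschitz_on UNIV (gradient \<gamma>)"
    and "\<exists>L. L-lipschitz_on UNIV (gradient \<rho>)"
    and "xbar \<in> ref_feasible \<gamma> \<rho> \<gamma>ref \<rho>ref"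
    and "stationary_max (ref_area \<gamma> \<rho> \<gamma>ref \<rho>ref) (ref_feasible \<gamma> \<rho> \<gamma>ref \<rho>ref) xbar"
    and "ref_area \<gamma> \<rho> \<gamma>ref \<rho>ref xbar > 0"
  shows "is_arg_max (ref_area \<gamma> \<rho> \<gamma>ref \<rho>ref) (\<lambda>x. x \<in> ref_feasible \<gamma> \<rho> \<gamma>ref \<rho>ref) xbar
    \<and> global_pareto_optimum \<gamma> \<rho> unit_simplex xbar"
proof -
  have max: "ref_area \<gamma> \<rho> \<gamma>ref \<rho>ref y \<le> ref_area \<gamma> \<rho> \<gamma>ref \<rho>ref xbar"
    if "y \<in> ref_feasible \<gamma> \<rho> \<gamma>ref \<rho>ref" for y
    using assms that
    by (intro stationary_ref_area_maximal) (auto simp: continuously_differentiable_def)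
  show ?thesis
  proof
    show "is_arg_max (ref_area \<gamma> \<rho> \<gamma>ref \<rho>ref) (\<lambda>x. x \<in> ref_feasible \<gamma> \<rho> \<gamma>ref \<rho>ref) xbar"
      using assms(7) max by (auto simp: is_arg_max_def not_less)
    show "global_pareto_optimum \<gamma> \<rho> unit_simplex xbar"
      using assms(7,9) max by (rule ref_area_maximal_imp_pareto)
  qed
qed

end
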